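(* Let $n$ and $p$ be positive integers (not necessarily coprime) and let $\kappa$ be an $n,p$-core. Then $H_{n,p}(\kappa)=H_{p,n}(\kappa)$ as multisets.
   Context: A partition $\lambda$ is identified with its Young diagram $\{(i,j): i\in[\ell(\lambda)], j\in[\lambda_i]\}$ (row $i$, column $j$, rows numbered from the top); its elements are cells. The conjugate $\lambda'$ has $\lambda'_i=\#\{j:\lambda_j\ge i\}$. The hook length of cell $(i,j)$ is $h_\lambda(i,j)=\lambda_i-j+\lambda'_j-i+1$. A partition is an $n$-core if no cell has hook length $n$, and an $n,p$-core if it is both an $n$-core and a $p$-core. For an $n,p$-core $\kappa$ let $m$ be the hook length of the top-left cell (the maximal hook length). Let $H^c(m)$ be the set of hook lengths of the cells in the first column of $\kappa$ and $H^r(m)$ the set of hook lengths of the cells in the first row. For $h\in H^c(m)$, the row whose leftmost cell has hook length $h$ is called an $n$-row if $h+n\notin H^c(m)$ (and a $p$-row if $h+p\notin H^c(m)$). For $h\in H^r(m)$, the column whose top cell has hook length $h$ is called an $n$-column if $h+n\notin H^r(m)$ (and a $p$-column if $h+p\notin H^r(m)$). $H_{n,p}(\kappa)$ denotes the multiset of hook lengths of the cells of $\kappa$ that lie both in an $n$-row and in a $p$-column; $H_{p,n}(\kappa)$ is defined likewise with the roles of $n$ and $p$ exchanged (cells lying in a $p$-row and an $n$-column). *)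

theory Defs
  imports "HOL-Library.Multiset"
begin

text \<open>A partition is the list of its positive parts in weakly decreasing order (the empty list is
  the empty partition). Rows and columns are numbered from 1, as usual for Young diagrams, so
  part \<open>i\<close> is list entry \<open>i - 1\<close>.\<close>

definition is_partition :: "nat list \<Rightarrow> bool" where
  "is_partition lam \<longleftrightarrow> sorted_wrt (\<ge>) lam \<and> (\<forall>x\<in>set lam. x > 0)"

definition part :: "nat list \<Rightarrow> nat \<Rightarrow> nat" where
  "part lam i = (if 1 \<le> i \<and> i \<le> length lam then lam ! (i - 1) else 0)"

definition cells :: "nat list \<Rightarrow> (nat \<times> nat) set" where
  "cells lam = {(i, j). i \<in> {1..length lam} \<and> j \<in> {1..part lam i}}"

definition conj_part :: "nat list \<Rightarrow> nat \<Rightarrow> nat" where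
  "conj_part lam i = card {j \<in> {1..length lam}. part lam j \<ge> i}"

text \<open>On cells \<open>j \<le> part lam i\<close> and \<open>i \<le> conj_part lam j\<close>, so no subtraction truncates there.
  The value is only meaningful, and only used, on cells.\<close>

definition hook :: "nat list \<Rightarrow> nat \<Rightarrow> nat \<Rightarrow> nat" where
  "hook lam i j = (part lam i - j) + (conj_part lam j - i) + 1"

definition is_core :: "nat \<Rightarrow> nat list \<Rightarrow> bool" where
  "is_core n lam \<longleftrightarrow> is_partition lam \<and> (\<forall>(i, j) \<in> cells lam. hook lam i j \<noteq> n)"

definition is_core2 :: "nat \<Rightarrow> nat \<Rightarrow> nat list \<Rightarrow> bool" where
  "is_core2 n p lam \<longleftrightarrow> is_core n lam \<and> is_core p lam"

definition first_col_hooks :: "nat list \<Rightarrow> nat set" where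
  "first_col_hooks lam = {hook lam i 1 | i. (i, 1) \<in> cells lam}"

definition first_row_hooks :: "nat list \<Rightarrow> nat set" where
  "first_row_hooks lam = {hook lam 1 j | j. (1, j) \<in> cells lam}"

definition is_row :: "nat \<Rightarrow> nat list \<Rightarrow> nat \<Rightarrow> bool" where
  "is_row n lam i \<longleftrightarrow> (i, 1) \<in> cells lam \<and> hook lam i 1 + n \<notin> first_col_hooks lam"

definition is_column :: "nat \<Rightarrow> nat list \<Rightarrow> nat \<Rightarrow> bool" where
  "is_column n lam j \<longleftrightarrow> (1, j) \<in> cells lam \<and> hook lam 1 j + n \<notin> first_row_hooks lam"

definition hook_mset :: "nat \<Rightarrow> nat \<Rightarrow> nat list \<Rightarrow> nat multiset" where
  "hook_mset n p lam =
     image_mset (\<lambda>(i, j). hook lam i j)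
       (mset_set {(i, j) \<in> cells lam. is_row n lam i \<and> is_column p lam j})"

text \<open>\<open>mset_set\<close> of an infinite set would be empty; diagrams are finite.\<close>

lemma finite_cells: "finite (cells lam)"
proof -
  have "cells lam = Sigma {1..length lam} (\<lambda>i. {1..part lam i})"
    by (auto simp: cells_def)
  then show ?thesis by simp
qed

end

theory Submission
  imports Defs
begin

text \<open>Let \<open>B\<close> be the set of first-column hook lengths. Cells of the diagram correspond to pairs
  \<open>(t, b)\<close> with \<open>t \<notin> B\<close>, \<open>b \<in> B\<close>, \<open>t < b\<close>, the hook length being \<open>b - t\<close>. Let \<open>c k\<close> be the number
  of cells of hook length \<open>k\<close>. Being an \<open>n\<close>-core means that the complement of \<open>B\<close> is closed under
  adding \<open>n\<close>, so that inclusion--exclusion over the conditions \<open>b + n \<notin> B\<close> (\<open>n\<close>-row) and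
  \<open>t - p \<in> B\<close> or \<open>t < p\<close> (\<open>p\<close>-column) shows that the hook length \<open>d\<close> has multiplicity
  \<open>c d - c (d + n) - c (d + p) + c (d + n + p)\<close> in \<open>hook_mset n p\<close>. This is symmetric in \<open>n\<close> and \<open>p\<close>.\<close>

section \<open>Counting gap-bead pairs in a finite set\<close>

definition bead_set_hooks :: "nat set \<Rightarrow> nat \<Rightarrow> nat set" where
  "bead_set_hooks B k = {t. t \<notin> B \<and> t + k \<in> B}"

text \<open>A pair is recorded by its lower end \<open>t\<close>; the upper end is
  \<open>t + d\<close>. The guard \<open>p \<le> t\<close> keeps \<open>t - p\<close> from
  truncating to 0: every \<open>t < p\<close> satisfies the column condition.\<close>

definition row_column_hooks :: "nat set \<Rightarrow> nat \<Rightarrow> nat \<Rightarrow> nat \<Rightarrow> nat set" where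
  "row_column_hooks B n p d =
     {t. t \<notin> B \<and> t + d \<in> B \<and> t + d + n \<notin> B \<and> \<not> (p \<le> t \<and> t - p \<notin> B)}"

lemma finite_bead_set_hooks:
  assumes "finite B"
  shows "finite (bead_set_hooks B k)"
proof (rule finite_subset)
  show "bead_set_hooks B k \<subseteq> {..Max B}"
    using Max_ge[OF assms] by (fastforce simp: bead_set_hooks_def)
qed simp

text \<open>Stated with sums to avoid truncated subtraction. All terms but the first are symmetric
  in \<open>n\<close> and \<open>p\<close>, which is what the theorem rests on.\<close>

lemma card_row_column_hooks:
  assumes fin: "finite B"
    and n: "\<And>t. t \<notin> B \<Longrightarrow> t + n \<notin> B"
    and p: "\<And>t. t \<notin> B \<Longrightarrow> t + p \<notin> B"
  shows "card (row_column_hooks B n p d)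
           + card (bead_set_hooks B (d + n)) + card (bead_set_hooks B (d + p))
         = card (bead_set_hooks B d) + card (bead_set_hooks B (d + n + p))"
proof -
  let ?H = "bead_set_hooks B"
  \<comment> \<open>Closure makes the sets nested: if \<open>t + k + n\<close> is in
    \<open>B\<close>, so is \<open>t + k\<close>. Hence the pairs failing the row condition can be
    subtracted exactly.\<close>
  have core_n: "card (?H k) = card (?H k - ?H (k + n)) + card (?H (k + n))" for k
  proof -
    have sub: "?H (k + n) \<subseteq> ?H k"
      using n[of "_ + k"] unfolding bead_set_hooks_def add.assoc[symmetric] by blast
    then show ?thesis
      using finite_bead_set_hooks[OF fin] card_mono[OF finite_bead_set_hooks[OF fin] sub]
      by (simp add: card_Diff_subset)
  qed
  \<comment> \<open>A pair that fails the column condition keeps its upper end when \<open>t\<close>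
    is lowered by \<open>p\<close>, so its difference becomes \<open>d + p\<close>. Closure under
    adding \<open>p\<close> makes this reversible.\<close>
  have split: "?H d - ?H (d + n)
      = row_column_hooks B n p d \<union> (\<lambda>u. u + p) ` (?H (d + p) - ?H (d + p + n))"
    (is "_ = ?R \<union> ?Q")
  proof (intro equalityI subsetI)
    fix t assume t: "t \<in> ?H d - ?H (d + n)"
    show "t \<in> ?R \<union> ?Q"
    proof (cases "p \<le> t \<and> t - p \<notin> B")
      case True
      then have "t = (t - p) + p" "t - p \<in> ?H (d + p) - ?H (d + p + n)"
        using t by (auto simp: bead_set_hooks_def algebra_simps)
      then show ?thesis by blast
    next
      case False
      then show ?thesis
        using t by (auto simp: bead_set_hooks_def row_column_hooks_def algebra_simps)
    qed
  next
    fix t assume "t \<in> ?R \<union> ?Q"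
    then consider "t \<in> ?R" | u where "t = u + p" "u \<in> ?H (d + p) - ?H (d + p + n)" by blast
    then show "t \<in> ?H d - ?H (d + n)"
    proof cases
      case 1
      then show ?thesis by (simp add: bead_set_hooks_def row_column_hooks_def add.assoc)
    next
      case 2
      then show ?thesis using p[of u] by (auto simp: bead_set_hooks_def ac_simps)
    qed
  qed
  have disj: "?R \<inter> ?Q = {}"
    by (auto simp: bead_set_hooks_def row_column_hooks_def)
  have finR: "finite ?R"
    by (rule finite_subset[OF _ finite_bead_set_hooks[OF fin, of d]])
      (auto simp: bead_set_hooks_def row_column_hooks_def)
  have "card (?H d - ?H (d + n)) = card ?R + card ?Q"
    unfolding split using finR finite_bead_set_hooks[OF fin] disj
    by (intro card_Un_disjoint) auto
  also have "card ?Q = card (?H (d + p) - ?H (d + p + n))"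
    by (intro card_image) (auto simp: inj_on_def)
  finally show ?thesis
    using core_n[of d] core_n[of "d + p"] by (simp add: algebra_simps)
qed

section \<open>Parts and conjugate parts\<close>

lemma part_antimono:
  assumes "is_partition lam" "1 \<le> i" "i \<le> i'" "i' \<le> length lam"
  shows "part lam i' \<le> part lam i"
proof (cases "i = i'")
  case False
  then have "i - 1 < i' - 1" "i' - 1 < length lam" using assms by auto
  then show ?thesis
    using assms by (auto simp: is_partition_def part_def sorted_wrt_iff_nth_less)
qed simp

lemma part_pos:
  assumes "is_partition lam" "1 \<le> i" "i \<le> length lam"
  shows "0 < part lam i"
  using assms by (auto simp: is_partition_def part_def)

text \<open>The rows of length at least \<open>j\<close> form an initial segment, so counting them
  gives the last one.\<close>

lemma le_part_iff_le_conj_part: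
  assumes lam: "is_partition lam" and i: "1 \<le> i" "i \<le> length lam"
  shows "j \<le> part lam i \<longleftrightarrow> i \<le> conj_part lam j"
proof
  assume "j \<le> part lam i"
  then have "{1..i} \<subseteq> {k \<in> {1..length lam}. part lam k \<ge> j}"
    using part_antimono[OF lam] i by (fastforce intro: order_trans)
  from card_mono[OF _ this] show "i \<le> conj_part lam j"
    by (simp add: conj_part_def)
next
  show "j \<le> part lam i" if "i \<le> conj_part lam j"
  proof (rule ccontr)
    assume "\<not> j \<le> part lam i"
    then have "{k \<in> {1..length lam}. part lam k \<ge> j} \<subseteq> {1..<i}"
      using part_antimono[OF lam i(1)] by (force simp: not_le)
    from card_mono[OF _ this] that i show False
      by (simp add: conj_part_def)
  qed
qed

lemma conj_part_le_length: "conj_part lam j \<le> length lam"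
proof -
  have "card {k \<in> {1..length lam}. part lam k \<ge> j} \<le> card {1..length lam}"
    by (intro card_mono) auto
  then show ?thesis by (simp add: conj_part_def)
qed

lemma conj_part_antimono:
  assumes "j \<le> j'"
  shows "conj_part lam j' \<le> conj_part lam j"
  unfolding conj_part_def using assms by (intro card_mono) auto

section \<open>Beads and gaps on the boundary path\<close>

text \<open>Follow the boundary of the diagram from its bottom left corner, numbering steps from 0.
  The vertical step of row \<open>i\<close> has number \<open>bead lam i\<close>, the horizontal
  step of column \<open>j\<close> has number \<open>gap lam j\<close>.\<close>

definition bead :: "nat list \<Rightarrow> nat \<Rightarrow> nat" where
  "bead lam i = part lam i + (length lam - i)"

definition gap :: "nat list \<Rightarrow> nat \<Rightarrow> nat" where
  "gap lam j = (j - 1) + (length lam - conj_part lam j)"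

definition beads :: "nat list \<Rightarrow> nat set" where
  "beads lam = bead lam ` {1..length lam}"

lemma finite_beads: "finite (beads lam)"
  by (simp add: beads_def)

lemma hook_add_gap:
  assumes "is_partition lam" "(i, j) \<in> cells lam"
  shows "hook lam i j + gap lam j = bead lam i"
proof -
  have "1 \<le> i" "i \<le> length lam" "1 \<le> j" "j \<le> part lam i"
    using assms by (auto simp: cells_def)
  moreover from this have "i \<le> conj_part lam j"
    using le_part_iff_le_conj_part[OF assms(1)] by blast
  ultimately show ?thesis
    using conj_part_le_length[of lam j] by (simp add: hook_def gap_def bead_def)
qed

text \<open>On a cell the difference is a positive hook length; off the diagram both arm and leg
  reverse, so the inequality is strictly opposite and equality never occurs.\<close>

lemma gap_less_bead_iff:
  assumes "is_partition lam" "1 \<le> i" "i \<le> length lam" "1 \<le> j"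
  shows "gap lam j < bead lam i \<longleftrightarrow> j \<le> part lam i"
    and "gap lam j \<noteq> bead lam i"
proof -
  have "hook lam i j > 0" by (simp add: hook_def)
  then have "gap lam j < bead lam i" if "j \<le> part lam i"
    using hook_add_gap[OF assms(1), of i j] that assms by (simp add: cells_def)
  moreover have "bead lam i < gap lam j" if "\<not> j \<le> part lam i"
    using le_part_iff_le_conj_part[OF assms(1-3), of j] that assms
    by (simp add: bead_def gap_def)
  ultimately show "gap lam j < bead lam i \<longleftrightarrow> j \<le> part lam i" "gap lam j \<noteq> bead lam i"
    by force+
qed

lemma inj_on_bead:
  assumes "is_partition lam"
  shows "inj_on (bead lam) {1..length lam}"
proof (rule linorder_inj_onI')
  fix i j assume "i \<in> {1..length lam}" "j \<in> {1..length lam}" "i < j"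
  then show "bead lam i \<noteq> bead lam j"
    using part_antimono[OF assms, of i j] by (simp add: bead_def)
qed

lemma inj_on_gap: "inj_on (gap lam) {1..}"
proof (rule linorder_inj_onI')
  fix i j :: nat assume "i \<in> {1..}" "j \<in> {1..}" "i < j"
  then show "gap lam i \<noteq> gap lam j"
    using conj_part_antimono[of i j lam] by (simp add: gap_def)
qed

lemma bead_le_bead_1:
  assumes "is_partition lam" "1 \<le> i" "i \<le> length lam"
  shows "bead lam i \<le> bead lam 1"
  using part_antimono[OF assms(1), of 1 i] assms by (simp add: bead_def)

text \<open>By counting: the gaps are distinct non-beads below
  \<open>bead lam 1 = part lam 1 + length lam - 1\<close>, and exactly \<open>part lam 1\<close>
  such numbers remain once the \<open>length lam\<close> beads are removed.\<close>

lemma gap_image: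
  assumes lam: "is_partition lam" and ne: "lam \<noteq> []"
  shows "gap lam ` {1..part lam 1} = {t. t \<notin> beads lam \<and> t < bead lam 1}"
proof -
  have l: "1 \<le> length lam" using ne by (cases lam) auto
  have B: "beads lam \<subseteq> {..bead lam 1}"
    using bead_le_bead_1[OF lam] by (auto simp: beads_def)
  have eq: "{t. t \<notin> beads lam \<and> t < bead lam 1} = {..bead lam 1} - beads lam"
    using l by (auto simp: beads_def le_less)
  have "card (beads lam) = length lam"
    using card_image[OF inj_on_bead[OF lam]] by (simp add: beads_def)
  then have "card ({..bead lam 1} - beads lam) = part lam 1"
    using card_Diff_subset[OF finite_beads B] l by (simp add: bead_def)
  moreover have "card (gap lam ` {1..part lam 1}) = part lam 1"
    using card_image[OF inj_on_subset[OF inj_on_gap], of "{1..part lam 1}"] by auto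
  moreover have "gap lam ` {1..part lam 1} \<subseteq> {t. t \<notin> beads lam \<and> t < bead lam 1}"
  proof clarify
    fix j assume "j \<in> {1..part lam 1}"
    then show "gap lam j \<notin> beads lam \<and> gap lam j < bead lam 1"
      using gap_less_bead_iff[OF lam] l by (auto simp: beads_def)
  qed
  ultimately show ?thesis
    unfolding eq by (intro card_subset_eq) auto
qed

text \<open>Converse of \<open>hook_add_gap\<close>: every gap-bead pair in the right order comes
  from a cell.\<close>

lemma cell_of_bead_gap:
  assumes lam: "is_partition lam" and t: "t \<notin> beads lam" and b: "b \<in> beads lam" and "t < b"
  obtains i j where "(i, j) \<in> cells lam" "bead lam i = b" "gap lam j = t" "hook lam i j = b - t"
proof -
  obtain i where i: "1 \<le> i" "i \<le> length lam" "b = bead lam i"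
    using b by (auto simp: beads_def)
  then have "t \<in> gap lam ` {1..part lam 1}"
    using gap_image[OF lam] bead_le_bead_1[OF lam i(1,2)] t \<open>t < b\<close> by fastforce
  then obtain j where j: "1 \<le> j" "t = gap lam j" by auto
  then have c: "(i, j) \<in> cells lam"
    using gap_less_bead_iff[OF lam i(1,2) j(1)] \<open>t < b\<close> i by (simp add: cells_def)
  show ?thesis
    using that[OF c] hook_add_gap[OF lam c] i j by simp
qed

lemma core_beads:
  assumes "is_core n lam" "n > 0" "t \<notin> beads lam"
  shows "t + n \<notin> beads lam"
proof
  assume "t + n \<in> beads lam"
  moreover have "is_partition lam" using assms(1) by (simp add: is_core_def)
  ultimately obtain i j where "(i, j) \<in> cells lam" "hook lam i j = n"
    using cell_of_bead_gap[of lam t "t + n"] assms(2,3)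
    by (metis add_diff_cancel_left' less_add_same_cancel1)
  then show False using assms(1) by (auto simp: is_core_def)
qed

section \<open>Row and column conditions in terms of beads\<close>

lemma hook_first_column:
  assumes lam: "is_partition lam" and c: "(i, 1) \<in> cells lam"
  shows "hook lam i 1 = bead lam i"
proof -
  have "1 \<le> length lam" using c by (auto simp: cells_def)
  \<comment> \<open>Column 1 meets every row, so \<open>gap lam 1 = 0\<close>.\<close>
  then have "length lam \<le> conj_part lam 1"
    using le_part_iff_le_conj_part[OF lam, of "length lam" 1] part_pos[OF lam, of "length lam"]
    by (simp add: Suc_le_eq)
  then show ?thesis
    using hook_add_gap[OF lam c] by (simp add: gap_def)
qed

lemma first_col_hooks_eq_beads:
  assumes lam: "is_partition lam"
  shows "first_col_hooks lam = beads lam"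
proof -
  have "(i, 1) \<in> cells lam \<longleftrightarrow> i \<in> {1..length lam}" for i
    using part_pos[OF lam, of i] by (auto simp: cells_def Suc_le_eq)
  then show ?thesis
    using hook_first_column[OF lam] unfolding first_col_hooks_def beads_def by fastforce
qed

lemma is_row_iff:
  assumes lam: "is_partition lam" and c: "(i, j) \<in> cells lam"
  shows "is_row n lam i \<longleftrightarrow> bead lam i + n \<notin> beads lam"
proof -
  have "(i, 1) \<in> cells lam" using c by (auto simp: cells_def)
  then show ?thesis
    using hook_first_column[OF lam] first_col_hooks_eq_beads[OF lam] by (simp add: is_row_def)
qed

text \<open>First-row hook lengths are \<open>bead lam 1 - gap lam k\<close>, so raising one by
  \<open>n\<close> means lowering the gap by \<open>n\<close>.\<close>

lemma is_column_iff:
  assumes lam: "is_partition lam" and c: "(i, j) \<in> cells lam"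
  shows "is_column n lam j \<longleftrightarrow> \<not> (n \<le> gap lam j \<and> gap lam j - n \<notin> beads lam)"
proof -
  have l: "1 \<le> length lam" "lam \<noteq> []" using c by (auto simp: cells_def)
  have c1: "(1, j) \<in> cells lam"
    using c part_antimono[OF lam, of 1 i] by (auto simp: cells_def)
  have mem: "(1, k) \<in> cells lam \<longleftrightarrow> k \<in> {1..part lam 1}" for k
    using l by (auto simp: cells_def)
  have hook1: "hook lam 1 k + gap lam k = bead lam 1" if "k \<in> {1..part lam 1}" for k
    using hook_add_gap[OF lam] mem that by blast
  have "hook lam 1 j + n \<in> first_row_hooks lam
      \<longleftrightarrow> (\<exists>k\<in>{1..part lam 1}. hook lam 1 j + n = hook lam 1 k)"
    using mem by (auto simp: first_row_hooks_def)
  also have "\<dots> \<longleftrightarrow> (\<exists>k\<in>{1..part lam 1}. gap lam j = gap lam k + n)"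
  proof (intro bex_cong refl)
    fix k assume "k \<in> {1..part lam 1}"
    then show "hook lam 1 j + n = hook lam 1 k \<longleftrightarrow> gap lam j = gap lam k + n"
      using hook1[of k] hook1[of j] c1 mem by auto
  qed
  also have "\<dots> \<longleftrightarrow> (\<exists>t \<in> gap lam ` {1..part lam 1}. gap lam j = t + n)"
    by blast
  \<comment> \<open>The bound \<open>t < bead lam 1\<close> from \<open>gap_image\<close> is
    automatic here, since \<open>gap lam j\<close> already lies below
    \<open>bead lam 1\<close>.\<close>
  also have "\<dots> \<longleftrightarrow> n \<le> gap lam j \<and> gap lam j - n \<notin> beads lam"
    using hook1[of j] c1 mem unfolding gap_image[OF lam l(2)]
    by (auto simp: hook_def intro!: exI[of _ "gap lam j - n"])
  finally show ?thesis
    using c1 by (simp add: is_column_def)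
qed

section \<open>Multiplicities of hook lengths\<close>

lemma count_hook_mset:
  assumes lam: "is_partition lam"
  shows "count (hook_mset n p lam) d = card (row_column_hooks (beads lam) n p d)"
proof -
  let ?A = "{(i, j) \<in> cells lam. is_row n lam i \<and> is_column p lam j}"
  let ?D = "{(i, j) \<in> ?A. hook lam i j = d}"
  have fin: "finite ?A"
    by (rule finite_subset[OF _ finite_cells[of lam]]) auto
  have "count (hook_mset n p lam) d = card ?D"
  proof -
    have "(\<lambda>(i, j). hook lam i j) -` {d} \<inter> ?A = ?D" by auto
    then have "count (hook_mset n p lam) d = (\<Sum>x\<in>?D. count (mset_set ?A) x)"
      using fin by (simp add: hook_mset_def count_image_mset)
    also have "\<dots> = (\<Sum>x\<in>?D. 1)"
      using fin by (intro sum.cong refl count_mset_set(1)) auto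
    finally show ?thesis by simp
  qed
  also have "card ?D = card (row_column_hooks (beads lam) n p d)"
  \<comment> \<open>With \<open>d\<close> fixed, the gap determines the bead, hence both the column
    and the row.\<close>
  proof (rule bij_betw_same_card[of "\<lambda>(i, j). gap lam j"], rule bij_betw_imageI)
    show "inj_on (\<lambda>(i, j). gap lam j) ?D"
    proof (rule inj_onI, clarify)
      fix i j i' j'
      assume c: "(i, j) \<in> cells lam" and c': "(i', j') \<in> cells lam"
        and g: "gap lam j = gap lam j'" and d: "hook lam i' j' = hook lam i j"
      have "j = j'"
        using inj_onD[OF inj_on_gap g] c c' by (auto simp: cells_def)
      moreover have "bead lam i = bead lam i'"
        using hook_add_gap[OF lam c] hook_add_gap[OF lam c'] g d by simp
      then have "i = i'"
        using inj_onD[OF inj_on_bead[OF lam]] c c' by (auto simp: cells_def)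
      ultimately show "i = i' \<and> j = j'" by simp
    qed
    show "(\<lambda>(i, j). gap lam j) ` ?D = row_column_hooks (beads lam) n p d"
    proof (intro equalityI subsetI)
      fix t assume "t \<in> (\<lambda>(i, j). gap lam j) ` ?D"
      then obtain i j where c: "(i, j) \<in> cells lam" and row: "is_row n lam i"
        and col: "is_column p lam j" and d: "hook lam i j = d" and t: "t = gap lam j" by auto
      have "t + d = bead lam i"
        using hook_add_gap[OF lam c] d t by simp
      moreover have "bead lam i \<in> beads lam" "t \<notin> beads lam"
        using c gap_less_bead_iff(2)[OF lam] t by (auto simp: beads_def cells_def)
      ultimately show "t \<in> row_column_hooks (beads lam) n p d"
        using row col is_row_iff[OF lam c] is_column_iff[OF lam c] t
        by (simp add: row_column_hooks_def)
    next
      fix t assume t: "t \<in> row_column_hooks (beads lam) n p d"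
      then have "d \<noteq> 0" by (cases d) (auto simp: row_column_hooks_def)
      then obtain i j where c: "(i, j) \<in> cells lam" and ij: "bead lam i = t + d" "gap lam j = t"
        "hook lam i j = d"
        using cell_of_bead_gap[OF lam, of t "t + d"] t by (auto simp: row_column_hooks_def)
      then have "(i, j) \<in> ?D"
        using t is_row_iff[OF lam c] is_column_iff[OF lam c] by (simp add: row_column_hooks_def)
      then show "t \<in> (\<lambda>(i, j). gap lam j) ` ?D"
        using ij(2) by force
    qed
  qed
  finally show ?thesis .
qed

theorem theorem1p3:
  fixes n p :: nat and \<kappa> :: "nat list"
  assumes "n > 0" and "p > 0"
    and "is_core2 n p \<kappa>"
  shows "hook_mset n p \<kappa> = hook_mset p n \<kappa>"
proof (rule multiset_eqI)
  fix d
  have cores: "is_core n \<kappa>" "is_core p \<kappa>" and part: "is_partition \<kappa>"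
    using assms(3) by (auto simp: is_core2_def is_core_def)
  note n = core_beads[OF cores(1) assms(1)] and p = core_beads[OF cores(2) assms(2)]
  show "count (hook_mset n p \<kappa>) d = count (hook_mset p n \<kappa>) d"
    \<comment> \<open>The two instances differ only in the first summand and the order of addition,
      so the remaining terms cancel.\<close>
    using card_row_column_hooks[OF finite_beads n p, of d]
      card_row_column_hooks[OF finite_beads p n, of d]
    by (simp add: count_hook_mset[OF part] algebra_simps)
qed

end
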